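(* Let $R$ be a linear commutative ring with unity, let $n\in\mathbb{N}$ with $n\geq 1$, and let $f_{1},\ldots,f_{n+1}\colon R\to R$ be additive functions such that $f_{i}(1)=0$ for all $i=1,\ldots,n+1$. Then the functional equation $$\sum_{i=0}^{n}x^{i}f_{n+1-i}\left(x^{n+1-i}\right)=0$$ holds for all $x\in R$ if and only if there exist $D_{j}\in\mathscr{D}_{j}(R)$ $(j=0,\ldots,n)$ such that $$f_{n+1-i}=(-1)^{i}\sum_{k=0}^{i}\binom{n+1-i+k}{k}D_{n-i+k}\qquad (i=0,\ldots,n).$$
   Context: A commutative unitary ring $R$ is called linear if it is a linear space over the field $\mathbb{Q}$ of rationals. A mapping $f\colon R\to R$ is additive if $f(x+y)=f(x)+f(y)$ for all $x,y\in R$. Higher order derivations: let $R$ be a ring. The identically zero map is the only derivation of order zero. For each integer $n\ge 1$, an additive mapping $f\colon R\to R$ is a derivation of order $n$ if there exists $B\colon R\times R\to R$ such that $B$ is a bi-derivation of order $n-1$ (that is, $B$ is a derivation of order $n-1$ in each variable, the other variable being fixed) and $f(xy)-xf(y)-f(x)y=B(x,y)$ for all $x,y\in R$. The set of derivations of order $n$ of $R$ is denoted by $\mathscr{D}_{n}(R)$. Convention: $x^0=1$ for all $x\in R$. *)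

theory Defs
  imports Complex_Main
begin

(* The sort {comm_ring, comm_monoid_mult} describes commutative rings with unity.
   Unlike comm_ring_1 it does not impose 0 \<noteq> 1, so the zero ring is included. *)

primrec derivation_of_order ::
    "nat \<Rightarrow> ('a::{comm_ring, comm_monoid_mult} \<Rightarrow> 'a) \<Rightarrow> bool" where
  "derivation_of_order 0 f \<longleftrightarrow> (\<forall>x. f x = 0)"
| "derivation_of_order (Suc n) f \<longleftrightarrow>
     Modules.additive f \<and>
     (\<exists>B. (\<forall>y. derivation_of_order n (\<lambda>x. B x y)) \<and>
          (\<forall>x. derivation_of_order n (\<lambda>y. B x y)) \<and>
          (\<forall>x y. f (x * y) - x * f y - f x * y = B x y))"

definition derivations ::
    "nat \<Rightarrow> ('a::{comm_ring, comm_monoid_mult} \<Rightarrow> 'a) set" where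
  "derivations n = {f. derivation_of_order n f}"

end

theory Submission
  imports Defs
begin

text \<open>
  For additive \<open>h\<close> with \<open>h 1 = 0\<close>, being a derivation of order \<open>p\<close> is equivalent to the vanishing
  of the alternating sum \<open>\<Sum>t\<le>p+1. (-1)\<^sup>p\<^sup>+\<^sup>1\<^sup>+\<^sup>t (p+1 choose t) x\<^sup>p\<^sup>+\<^sup>1\<^sup>-\<^sup>t h(x\<^sup>t)\<close> for all \<open>x\<close>.
  One direction is Pascal's rule; for the other, replacing \<open>x\<close> by \<open>x + q a\<close> and comparing
  coefficients of \<open>q\<close> turns the identity of degree \<open>p + 1\<close> for \<open>h\<close> into the identity of
  degree \<open>p\<close> for \<open>y \<mapsto> h(a y) - a h(y)\<close>.

  For a solution \<open>f\<close> of \<open>\<Sum>m\<le>N. x\<^sup>N\<^sup>-\<^sup>m f\<^sub>m(x\<^sup>m) = 0\<close> put \<open>d\<^sub>p = \<Sum>m. (m choose p) f\<^sub>m\<close>.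
  The same linearization with \<open>a = 1\<close> gives an equation of degree \<open>N - 1\<close> whose \<open>d\<^sub>p\<close> is the old
  one multiplied by \<open>N - p\<close>. Hence by induction on \<open>N\<close> the alternating sums of degree \<open>p < N\<close>
  vanish for \<open>d\<^sub>p\<close>, and binomial inversion rewrites the equation itself as the missing case
  \<open>p = N\<close>. Up to sign, \<open>D\<^sub>j\<close> is \<open>d\<^sub>j\<^sub>+\<^sub>1\<close>.
\<close>

section \<open>Orthogonality of binomial coefficients\<close>

text \<open>For \<open>t \<le> j \<le> m\<close>, \<open>(m choose j) * (j choose t) = (m choose t)
  * ((m - t) choose (j - t))\<close>, which leaves an alternating sum over row \<open>m - t\<close>
  of Pascal's triangle.\<close>

lemma binomial_orthogonality:
  assumes "m \<le> N"
  shows "(\<Sum>j\<le>N. (-1) ^ (j + t) * of_nat (j choose t) * of_nat (m choose j)) =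
    (if m = t then 1 else 0 :: rat)"
proof -
  have "(\<Sum>j\<le>N. (-1) ^ (j + t) * of_nat (j choose t) * of_nat (m choose j)) =
      (\<Sum>j\<in>{t..m}. (-1) ^ (j + t) * of_nat (j choose t) * of_nat (m choose j) :: rat)"
    using assms by (intro sum.mono_neutral_right) (auto simp: not_le)
  also have "\<dots> = (if m = t then 1 else 0)"
  proof (cases "t \<le> m")
    case True
    have "(\<Sum>j\<in>{t..m}. (-1) ^ (j + t) * of_nat (j choose t) * of_nat (m choose j) :: rat) =
      (\<Sum>i\<le>m - t. (-1) ^ (i + t + t) * of_nat ((i + t) choose t) * of_nat (m choose (i + t)))"
      by (rule sum.reindex_bij_witness[where i = "\<lambda>i. i + t" and j = "\<lambda>j. j - t"])
        (use True in auto)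
    also have "\<dots> = (\<Sum>i\<le>m - t. of_nat (m choose t) * ((-1) ^ i * of_nat ((m - t) choose i)))"
    proof (rule sum.cong)
      fix i assume "i \<in> {..m - t}"
      then have "(m choose (i + t)) * ((i + t) choose t) = (m choose t) * ((m - t) choose i)"
        using True choose_mult[of t "i + t" m] by simp
      then have "of_nat (m choose (i + t)) * of_nat ((i + t) choose t) =
          (of_nat (m choose t) * of_nat ((m - t) choose i) :: rat)"
        by (metis of_nat_mult)
      then show "(-1) ^ (i + t + t) * of_nat ((i + t) choose t) * of_nat (m choose (i + t)) =
          (of_nat (m choose t) * ((-1) ^ i * of_nat ((m - t) choose i)) :: rat)"
        by (simp add: power_add mult_ac flip: power_mult_distrib)
    qed simp
    also have "\<dots> = of_nat (m choose t) * (\<Sum>i\<le>m - t. (-1) ^ i * of_nat ((m - t) choose i))"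
      by (simp add: sum_distrib_left)
    also have "\<dots> = (if m = t then 1 else 0)"
      using True choose_alternating_sum[of "m - t", where ?'a = rat] by auto
    finally show ?thesis .
  qed auto
  finally show ?thesis .
qed

section \<open>Rational scalars and additive maps\<close>

text \<open>Compatibility of \<open>scale\<close> with the ring product is derived rather than
  assumed: multiplication by a fixed element is additive, hence rational-linear.\<close>

locale rational_algebra = vector_space scale
  for scale :: "rat \<Rightarrow> 'a::{comm_ring, comm_monoid_mult} \<Rightarrow> 'a"
begin

lemma additive_scale_of_nat:
  assumes "Modules.additive h"
  shows "h (scale (of_nat k) x) = scale (of_nat k) (h x)"
  by (induction k)
    (simp_all add: additive.zero[OF assms] additive.add[OF assms] scale_left_distrib)

lemma additive_scale_of_int:
  assumes "Modules.additive h"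
  shows "h (scale (of_int k) x) = scale (of_int k) (h x)"
proof (cases k rule: int_cases2)
  case (nonneg n)
  then show ?thesis by (simp add: additive_scale_of_nat[OF assms])
next
  case (nonpos n)
  then show ?thesis by (simp add: additive_scale_of_nat[OF assms] additive.minus[OF assms])
qed

lemma additive_scale:
  assumes "Modules.additive h"
  shows "h (scale q x) = scale q (h x)"
proof -
  obtain a b where ab: "b > 0" "q = of_int a / of_int b"
    by (metis quotient_of_denom_pos quotient_of_div surj_pair)
  have "scale (of_int b) (h (scale q x)) = h (scale (of_int a) x)"
    using ab by (simp flip: additive_scale_of_int[OF assms])
  also have "\<dots> = scale (of_int b) (scale q (h x))"
    using ab by (simp add: additive_scale_of_int[OF assms])
  finally show ?thesis using ab(1) unfolding scale_cancel_left by simp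
qed

lemma additive_mult_left: "Modules.additive (\<lambda>y. c * y :: 'a)"
  by (simp add: additive_def distrib_left)

lemma mult_scale_right: "x * scale q y = scale q (x * y)"
  by (rule additive_scale[OF additive_mult_left])

lemma mult_scale_left: "scale q x * y = scale q (x * y)"
  by (metis mult.commute mult_scale_right)

section \<open>Polynomial functions of a rational variable and their jets at 0\<close>

text \<open>The Horner form gives closure under sums, products and additive maps by plain induction,
  without tracking degrees or coefficients.\<close>

inductive polyfun :: "(rat \<Rightarrow> 'a) \<Rightarrow> bool" where
  const: "polyfun (\<lambda>q. c)"
| horner: "polyfun F \<Longrightarrow> polyfun (\<lambda>q. c + scale q (F q))"

lemma polyfun_sum_repr: "polyfun F \<Longrightarrow> \<exists>d c. \<forall>q. F q = (\<Sum>i<d. scale (q ^ i) (c i))"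
proof (induction rule: polyfun.induct)
  case (const c)
  show ?case by (rule exI[of _ 1], rule exI[of _ "\<lambda>_. c"]) simp
next
  case (horner F c)
  then obtain d b where "\<forall>q. F q = (\<Sum>i<d. scale (q ^ i) (b i))" by blast
  then show ?case
    by (intro exI[of _ "Suc d"] exI[of _ "case_nat c b"])
      (simp add: sum.lessThan_Suc_shift scale_sum_right del: sum.lessThan_Suc)
qed

text \<open>Comparing the values at \<open>2 q\<close> and \<open>q\<close> eliminates the leading coefficient.\<close>

lemma polynomial_coeffs_eq_0:
  assumes "\<And>q. q \<noteq> 0 \<Longrightarrow> (\<Sum>i<d. scale (q ^ i) (c i)) = 0"
  shows "\<forall>i<d. c i = 0"
  using assms
proof (induction d arbitrary: c)
  case (Suc d)
  have "(\<Sum>i<d. scale (q ^ i) (scale (2 ^ i - 2 ^ d) (c i))) = 0" if "q \<noteq> 0" for q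
  proof -
    have "(\<Sum>i<Suc d. scale ((2 * q) ^ i) (c i)) - scale (2 ^ d) (\<Sum>i<Suc d. scale (q ^ i) (c i)) = 0"
      using Suc.prems[of q] Suc.prems[of "2 * q"] that by simp
    then show ?thesis
      by (simp add: scale_sum_right scale_right_distrib sum_subtractf[symmetric]
          scale_left_diff_distrib scale_right_diff_distrib power_mult_distrib mult.commute)
  qed
  from Suc.IH[OF this] have "\<forall>i<d. scale (2 ^ i - 2 ^ d) (c i) = 0" by blast
  then have lower: "\<forall>i<d. c i = 0" by auto
  with Suc.prems[of 1] have "c d = 0" by simp
  with lower show ?case by (simp add: less_Suc_eq)
qed simp

text \<open>Serves to evaluate at 0 after a division by \<open>q\<close>, when an identity is known
  only for nonzero \<open>q\<close>.\<close>

lemma polyfun_eq_0_at_0: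
  assumes "polyfun F" and "\<And>q. q \<noteq> 0 \<Longrightarrow> F q = 0"
  shows "F 0 = 0"
proof -
  obtain d c where F: "\<And>q. F q = (\<Sum>i<d. scale (q ^ i) (c i))"
    using polyfun_sum_repr[OF assms(1)] by blast
  then have "\<forall>i<d. c i = 0" using assms(2) by (intro polynomial_coeffs_eq_0) simp
  then show ?thesis by (simp add: F)
qed

lemma polyfun_add: "polyfun F \<Longrightarrow> polyfun G \<Longrightarrow> polyfun (\<lambda>q. F q + G q)"
proof (induction arbitrary: G rule: polyfun.induct)
  case (const c)
  from const.prems show ?case
  proof cases
    case (const b)
    then show ?thesis by (simp add: polyfun.const)
  next
    case (horner F b)
    then show ?thesis using polyfun.horner[of F "c + b"] by (simp add: add.assoc)
  qed
next
  case (horner F c)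
  from horner.prems show ?case
  proof cases
    case (const b)
    then show ?thesis using polyfun.horner[OF horner.hyps, of "c + b"] by (simp add: ac_simps)
  next
    case (horner H b)
    then show ?thesis using polyfun.horner[OF horner.IH, of H "c + b"]
      by (simp add: ac_simps scale_right_distrib)
  qed
qed

lemma polyfun_additive:
  assumes "Modules.additive h"
  shows "polyfun F \<Longrightarrow> polyfun (\<lambda>q. h (F q))"
  by (induction rule: polyfun.induct)
    (simp_all add: polyfun.intros additive.add[OF assms] additive_scale[OF assms])

lemma polyfun_shift: "polyfun F \<Longrightarrow> polyfun (\<lambda>q. scale q (F q))"
  using polyfun.horner[of F 0] by simp

lemma polyfun_mult:
  assumes "polyfun F" and G: "polyfun G"
  shows "polyfun (\<lambda>q. F q * G q)"
  using assms(1)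
proof (induction rule: polyfun.induct)
  case (const c)
  show ?case using polyfun_additive[OF additive_mult_left G] .
next
  case (horner F c)
  show ?case
    using polyfun_add[OF polyfun_additive[OF additive_mult_left G, of c] polyfun_shift[OF horner.IH]]
    by (simp add: distrib_right mult_scale_left)
qed

text \<open>\<open>a\<close> and \<open>b\<close> are the value and the derivative at \<open>0\<close> of the polynomial function \<open>F\<close>.\<close>

definition jet :: "(rat \<Rightarrow> 'a) \<Rightarrow> 'a \<Rightarrow> 'a \<Rightarrow> bool" where
  "jet F a b \<longleftrightarrow> (\<exists>G. polyfun G \<and> (\<forall>q. F q = a + scale q (b + scale q (G q))))"

lemma jet_const: "jet (\<lambda>q. c) c 0"
  unfolding jet_def by (rule exI[of _ "\<lambda>_. 0"]) (simp add: polyfun.const)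

lemma jet_affine: "jet (\<lambda>q. a + scale q b) a b"
  unfolding jet_def by (rule exI[of _ "\<lambda>_. 0"]) (simp add: polyfun.const)

lemma jet_additive:
  assumes "Modules.additive h" and "jet F a b"
  shows "jet (\<lambda>q. h (F q)) (h a) (h b)"
proof -
  obtain G where "polyfun G" "\<And>q. F q = a + scale q (b + scale q (G q))"
    using assms(2) unfolding jet_def by blast
  then show ?thesis unfolding jet_def
    by (intro exI[of _ "\<lambda>q. h (G q)"])
      (simp add: polyfun_additive[OF assms(1)] additive.add[OF assms(1)] additive_scale[OF assms(1)])
qed

lemma jet_add:
  assumes "jet F a b" and "jet F' a' b'"
  shows "jet (\<lambda>q. F q + F' q) (a + a') (b + b')"
proof -
  obtain G where "polyfun G" "\<And>q. F q = a + scale q (b + scale q (G q))"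
    using assms(1) unfolding jet_def by blast
  moreover obtain G' where "polyfun G'" "\<And>q. F' q = a' + scale q (b' + scale q (G' q))"
    using assms(2) unfolding jet_def by blast
  ultimately show ?thesis unfolding jet_def
    by (intro exI[of _ "\<lambda>q. G q + G' q"])
      (simp add: polyfun_add scale_right_distrib ac_simps)
qed

lemma jet_sum:
  assumes "finite I" and "\<And>i. i \<in> I \<Longrightarrow> jet (F i) (a i) (b i)"
  shows "jet (\<lambda>q. \<Sum>i\<in>I. F i q) (\<Sum>i\<in>I. a i) (\<Sum>i\<in>I. b i)"
  using assms by (induction I rule: finite_induct) (simp_all add: jet_const jet_add)

lemma jet_mult:
  assumes "jet F a b" and "jet F' a' b'"
  shows "jet (\<lambda>q. F q * F' q) (a * a') (a * b' + b * a')"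
proof -
  obtain G where G: "polyfun G" "\<And>q. F q = a + scale q (b + scale q (G q))"
    using assms(1) unfolding jet_def by blast
  obtain G' where G': "polyfun G'" "\<And>q. F' q = a' + scale q (b' + scale q (G' q))"
    using assms(2) unfolding jet_def by blast
  \<comment> \<open>\<open>?H\<close> is what remains of the product after removing the terms of
    order 0 and 1 and dividing by \<open>q ^ 2\<close>.\<close>
  let ?H = "\<lambda>q. a * G' q + (b + scale q (G q)) * (b' + scale q (G' q)) + a' * G q"
  have "polyfun ?H"
    by (intro polyfun_add polyfun_mult polyfun.const polyfun_shift G G')
  moreover have "F q * F' q = a * a' + scale q ((a * b' + b * a') + scale q (?H q))" for q
    by (simp add: G(2) G'(2) algebra_simps mult_scale_left mult_scale_right scale_right_distrib)
  ultimately show ?thesis unfolding jet_def by blast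
qed

lemma jet_power:
  assumes "jet F a b"
  shows "jet (\<lambda>q. F q ^ m) (a ^ m) (scale (of_nat m) (b * a ^ (m - 1)))"
proof (induction m)
  case 0
  then show ?case using jet_const[of 1] by simp
next
  case (Suc m)
  \<comment> \<open>At \<open>m = 0\<close> the truncated exponent \<open>m - 1\<close> is harmless,
    since the scalar factor is 0.\<close>
  have "a * scale (of_nat m) (b * a ^ (m - 1)) = scale (of_nat m) (b * a ^ m)"
    by (cases m) (simp_all add: mult_scale_right mult.left_commute)
  then show ?case using jet_mult[OF assms Suc.IH]
    by (simp add: scale_left_distrib add.commute)
qed

text \<open>Evaluation at 0 gives \<open>a = 0\<close>; division by \<open>q\<close> then leaves a
  polynomial function that vanishes for nonzero \<open>q\<close>, hence also at 0, where its value
  is \<open>b\<close>.\<close>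

lemma jet_eq_0:
  assumes "jet F a b" and "\<And>q. F q = 0"
  shows "b = 0"
proof -
  obtain G where G: "polyfun G" "\<And>q. F q = a + scale q (b + scale q (G q))"
    using assms(1) unfolding jet_def by blast
  have "a = 0" using G(2)[of 0] assms(2) by simp
  then have "b + scale q (G q) = 0" if "q \<noteq> 0" for q
    using G(2)[of q] assms(2) that by simp
  from polyfun_eq_0_at_0[OF polyfun.horner[OF G(1)] this] show ?thesis by simp
qed

section \<open>Linearization of homogeneous equations\<close>

text \<open>The derivative of the identity at \<open>x\<close> in direction \<open>a\<close>,
  regrouped so that for \<open>a = 1\<close> it has the original shape in degree
  \<open>M\<close>.\<close>

lemma linearize:
  assumes add: "\<And>m. m \<le> Suc M \<Longrightarrow> Modules.additive (f m)"
    and zero: "\<And>x. (\<Sum>m\<le>Suc M. x ^ (Suc M - m) * f m (x ^ m)) = 0"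
  shows "(\<Sum>m\<le>M. x ^ (M - m) * (scale (of_nat (Suc M - m)) (a * f m (x ^ m)) +
    scale (of_nat (Suc m)) (f (Suc m) (a * x ^ m)))) = 0"
proof -
  \<comment> \<open>\<open>?b\<close> comes from differentiating the argument of \<open>f m\<close>,
    \<open>?c\<close> from differentiating the outer power.\<close>
  let ?b = "\<lambda>m. x ^ (Suc M - m) * f m (scale (of_nat m) (a * x ^ (m - 1)))"
  let ?c = "\<lambda>m. scale (of_nat (Suc M - m)) (a * x ^ (Suc M - m - 1)) * f m (x ^ m)"
  have "jet (\<lambda>q. \<Sum>m\<le>Suc M. (x + scale q a) ^ (Suc M - m) * f m ((x + scale q a) ^ m))
      (\<Sum>m\<le>Suc M. x ^ (Suc M - m) * f m (x ^ m)) (\<Sum>m\<le>Suc M. ?b m + ?c m)"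
  proof (rule jet_sum)
    fix m assume "m \<in> {..Suc M}"
    then have m: "m \<le> Suc M" by simp
    show "jet (\<lambda>q. (x + scale q a) ^ (Suc M - m) * f m ((x + scale q a) ^ m))
        (x ^ (Suc M - m) * f m (x ^ m)) (?b m + ?c m)"
      by (rule jet_mult[OF jet_power[OF jet_affine]
            jet_additive[OF add[OF m] jet_power[OF jet_affine]]])
  qed simp
  then have "(\<Sum>m\<le>Suc M. ?b m + ?c m) = 0"
    by (rule jet_eq_0) (rule zero)
  \<comment> \<open>\<open>?b 0\<close> vanishes, which allows the index shift; in the next sum
    \<open>?c (Suc M)\<close> vanishes.\<close>
  moreover have "(\<Sum>m\<le>Suc M. ?b m) = 
      (\<Sum>m\<le>M. x ^ (M - m) * scale (of_nat (Suc m)) (f (Suc m) (a * x ^ m)))"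
    by (subst sum.atMost_Suc_shift)
      (simp add: additive.zero[OF add] additive_scale[OF add] del: of_nat_Suc)
  moreover have "(\<Sum>m\<le>Suc M. ?c m) =
      (\<Sum>m\<le>M. x ^ (M - m) * scale (of_nat (Suc M - m)) (a * f m (x ^ m)))"
    by (simp add: mult_scale_left mult_scale_right mult_ac)
  ultimately show ?thesis
    by (simp add: sum.distrib distrib_left add.commute del: of_nat_Suc sum.atMost_Suc)
qed

section \<open>Deviations and higher order derivations\<close>

text \<open>A \<open>p\<close>-th forward difference in \<open>t\<close>, homogenized by powers of
  \<open>x\<close>; \<open>p + t\<close> has the parity of \<open>p - t\<close>. Derivations of
  order \<open>p\<close> correspond to the vanishing of \<open>deviation (Suc p)\<close>.\<close>

definition deviation :: "nat \<Rightarrow> ('a \<Rightarrow> 'a) \<Rightarrow> 'a \<Rightarrow> 'a" where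
  "deviation p h x =
    (\<Sum>t\<le>p. scale ((-1) ^ (p + t) * of_nat (p choose t)) (x ^ (p - t) * h (x ^ t)))"

lemma alternating_binomial_sum_Suc:
  "(\<Sum>t\<le>Suc p. scale ((-1) ^ (Suc p + t) * of_nat (Suc p choose t)) (w t)) =
   (\<Sum>t\<le>p. scale ((-1) ^ (p + t) * of_nat (p choose t)) (w (Suc t) - w t))"
proof -
  \<comment> \<open>One half of Pascal's rule. Its sum is computed twice: by dropping the last term,
    which is 0, and by splitting off the first.\<close>
  let ?b = "\<lambda>t. scale ((-1) ^ (Suc p + t) * of_nat (p choose t)) (w t)"
  have "(\<Sum>t\<le>Suc p. ?b t) = - (\<Sum>t\<le>p. scale ((-1) ^ (p + t) * of_nat (p choose t)) (w t))"
    by (simp add: sum_negf)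
  moreover have "(\<Sum>t\<le>Suc p. ?b t) = ?b 0 + (\<Sum>t\<le>p. ?b (Suc t))"
    by (rule sum.atMost_Suc_shift)
  moreover have "(\<Sum>t\<le>Suc p. scale ((-1) ^ (Suc p + t) * of_nat (Suc p choose t)) (w t)) =
      ?b 0 + (\<Sum>t\<le>p. ?b (Suc t)) + (\<Sum>t\<le>p. scale ((-1) ^ (p + t) * of_nat (p choose t)) (w (Suc t)))"
    by (subst sum.atMost_Suc_shift)
      (simp add: sum.distrib[symmetric] scale_left_distrib distrib_left add.assoc add.commute
        del: sum.atMost_Suc)
  ultimately show ?thesis
    by (simp add: scale_right_diff_distrib sum_subtractf del: sum.atMost_Suc)
qed

text \<open>For \<open>t \<le> p\<close>, the first difference in \<open>t\<close> of
  \<open>x ^ (Suc p - t) * h (x ^ t)\<close> is \<open>x ^ (p - t)\<close> times the new function at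
  \<open>x ^ t\<close>. That function depends on the evaluation point.\<close>

lemma deviation_Suc: "deviation (Suc p) h x = deviation p (\<lambda>y. h (x * y) - x * h y) x"
  unfolding deviation_def alternating_binomial_sum_Suc
  by (intro sum.cong refl arg_cong2[where f = scale])
    (simp add: Suc_diff_le right_diff_distrib mult_ac)

lemma deviation_add: "deviation p (\<lambda>y. h y + g y) x = deviation p h x + deviation p g x"
  by (simp add: deviation_def distrib_left scale_right_distrib sum.distrib)

lemma deviation_scale: "deviation p (\<lambda>y. scale q (h y)) x = scale q (deviation p h x)"
  by (simp add: deviation_def mult_scale_right scale_sum_right mult_ac)

lemma deviation_zero: "deviation p (\<lambda>y. 0) x = 0"
  by (simp add: deviation_def)

lemma deviation_mult: "deviation (Suc p) (\<lambda>y. c * y) x = 0"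
  by (simp add: deviation_Suc mult.left_commute deviation_zero)

lemma derivation_of_order_imp_deviation_eq_0:
  "derivation_of_order p h \<Longrightarrow> deviation (Suc p) h x = 0"
proof (induction p arbitrary: h)
  case 0
  then show ?case by (simp add: deviation_def)
next
  case (Suc p)
  then obtain B where B: "\<forall>x. derivation_of_order p (\<lambda>y. B x y)"
    and hB: "\<forall>x y. h (x * y) - x * h y - h x * y = B x y" by auto
  \<comment> \<open>The first argument of \<open>B\<close> is frozen at the evaluation point; the
    multiplication by \<open>h x\<close> has zero deviation.\<close>
  have "deviation (Suc (Suc p)) h x = deviation (Suc p) (\<lambda>y. B x y + h x * y) x"
    by (subst deviation_Suc) (simp flip: hB[rule_format])
  then show ?case by (simp add: deviation_add deviation_mult Suc.IH[OF B[rule_format]])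
qed

text \<open>At \<open>x = y = 1\<close> the left side of the product rule is \<open>- h 1\<close>,
  while \<open>B 1 1\<close> is 0 by induction.\<close>

lemma derivation_of_order_one: "derivation_of_order p h \<Longrightarrow> h 1 = 0"
proof (induction p arbitrary: h)
  case (Suc p)
  then obtain B where B: "\<forall>x. derivation_of_order p (\<lambda>y. B x y)"
    and hB: "\<forall>x y. h (x * y) - x * h y - h x * y = B x y" by auto
  show ?case using hB[rule_format, of 1 1] Suc.IH[OF B[rule_format, of 1]] by simp
qed simp

lemma deviation_linearize:
  assumes "Modules.additive h" and "\<And>x. deviation (Suc p) h x = 0"
  shows "deviation p (\<lambda>y. h (a * y) - a * h y) x = 0"
proof -
  let ?c = "\<lambda>m. (-1) ^ (Suc p + m) * of_nat (Suc p choose m) :: rat"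
  \<comment> \<open>By the absorption identities both families are \<open>Suc p\<close> times the
    coefficients of \<open>deviation p\<close>, with opposite signs; this produces the difference
    \<open>h (a * y) - a * h y\<close>.\<close>
  have c: "of_nat (Suc p - m) * ?c m = - (of_nat (Suc p) * ((-1) ^ (p + m) * of_nat (p choose m)))"
    "of_nat (Suc m) * ?c (Suc m) = of_nat (Suc p) * ((-1) ^ (p + m) * of_nat (p choose m))"
    if "m \<le> p" for m
  proof -
    have "(Suc p - m) * (Suc p choose m) = Suc p * (p choose m)"
      using binomial_absorb_comp[of "Suc p" m] by simp
    then have "of_nat (Suc p - m) * of_nat (Suc p choose m) = (of_nat (Suc p) * of_nat (p choose m) :: rat)"
      by (metis of_nat_mult)
    then show "of_nat (Suc p - m) * ?c m =
        - (of_nat (Suc p) * ((-1) ^ (p + m) * of_nat (p choose m)))"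
      by (simp add: mult.left_commute del: of_nat_Suc)
    have "Suc m * (Suc p choose Suc m) = Suc p * (p choose m)"
      by (rule Suc_times_binomial)
    then have "of_nat (Suc m) * of_nat (Suc p choose Suc m) = (of_nat (Suc p) * of_nat (p choose m) :: rat)"
      by (metis of_nat_mult)
    then show "of_nat (Suc m) * ?c (Suc m) =
        of_nat (Suc p) * ((-1) ^ (p + m) * of_nat (p choose m))"
      by (simp add: mult.left_commute del: of_nat_Suc binomial_Suc_Suc)
  qed
  have "(\<Sum>m\<le>p. x ^ (p - m) * (scale (of_nat (Suc p - m)) (a * scale (?c m) (h (x ^ m))) +
      scale (of_nat (Suc m)) (scale (?c (Suc m)) (h (a * x ^ m))))) = 0"
  proof (rule linearize[where f = "\<lambda>m y. scale (?c m) (h y)"])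
    show "Modules.additive (\<lambda>y. scale (?c m) (h y))" for m
      by (simp add: additive_def additive.add[OF assms(1)] scale_right_distrib)
    show "(\<Sum>m\<le>Suc p. y ^ (Suc p - m) * scale (?c m) (h (y ^ m))) = 0" for y
      using assms(2)[of y] unfolding deviation_def by (simp add: mult_scale_right del: sum.atMost_Suc)
  qed
  also have "(\<Sum>m\<le>p. x ^ (p - m) * (scale (of_nat (Suc p - m)) (a * scale (?c m) (h (x ^ m))) +
      scale (of_nat (Suc m)) (scale (?c (Suc m)) (h (a * x ^ m))))) =
      scale (of_nat (Suc p)) (deviation p (\<lambda>y. h (a * y) - a * h y) x)"
    unfolding deviation_def scale_sum_right
  proof (rule sum.cong)
    fix m assume "m \<in> {..p}"
    then have m: "m \<le> p" by simp
    show "x ^ (p - m) * (scale (of_nat (Suc p - m)) (a * scale (?c m) (h (x ^ m))) +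
      scale (of_nat (Suc m)) (scale (?c (Suc m)) (h (a * x ^ m)))) =
      scale (of_nat (Suc p)) (scale ((-1) ^ (p + m) * of_nat (p choose m))
        (x ^ (p - m) * (h (a * x ^ m) - a * h (x ^ m))))"
      unfolding mult_scale_right scale_scale c[OF m]
      by (simp add: distrib_left right_diff_distrib scale_right_diff_distrib mult_scale_right
          del: of_nat_Suc)
  qed simp
  finally show ?thesis by (simp del: of_nat_Suc)
qed

lemma deviation_eq_0_imp_derivation_of_order:
  assumes "Modules.additive h" and "h 1 = 0" and "\<And>x. deviation (Suc p) h x = 0"
  shows "derivation_of_order p h"
  using assms
proof (induction p arbitrary: h)
  case 0
  \<comment> \<open>\<open>deviation 1 h x\<close> is \<open>h x - x * h 1\<close>.\<close>
  then show ?case by (simp add: deviation_def)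
next
  case (Suc p)
  define B where "B x y = h (x * y) - x * h y - h x * y" for x y
  \<comment> \<open>The bracket is handled by \<open>deviation_linearize\<close> with
    \<open>a = x\<close>; the other summand is a multiplication map in \<open>y\<close>.\<close>
  have B_eq: "B x y = (h (x * y) - x * h y) + (- h x) * y" for x y
    by (simp add: B_def)
  have *: "derivation_of_order p (\<lambda>y. B x y)" for x
  proof (rule Suc.IH)
    show "Modules.additive (\<lambda>y. B x y)"
      by (simp add: additive_def B_def additive.add[OF Suc.prems(1)] algebra_simps)
    show "B x 1 = 0" using Suc.prems(2) by (simp add: B_def)
    show "deviation (Suc p) (\<lambda>y. B x y) z = 0" for z
      unfolding B_eq deviation_add deviation_mult
        deviation_linearize[OF Suc.prems(1,3)] by simp
  qed
  have "B x y = B y x" for x y by (simp add: B_def mult.commute)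
  then have "derivation_of_order p (\<lambda>x. B x y)" for y using *[of y] by simp
  moreover have "\<forall>x y. h (x * y) - x * h y - h x * y = B x y" by (simp add: B_def)
  ultimately show ?case using * Suc.prems(1) by (auto intro!: exI[of _ B])
qed

section \<open>Binomial inversion and separation of the equation\<close>

lemma sum_deviation:
  "(\<Sum>j\<le>N. x ^ (N - j) * deviation j (d j) x) =
   (\<Sum>m\<le>N. x ^ (N - m) * (\<Sum>j\<le>N. scale ((-1) ^ (j + m) * of_nat (j choose m)) (d j (x ^ m))))"
proof -
  have "(\<Sum>j\<le>N. x ^ (N - j) * deviation j (d j) x) =
    (\<Sum>j\<le>N. \<Sum>m\<le>N. x ^ (N - m) * scale ((-1) ^ (j + m) * of_nat (j choose m)) (d j (x ^ m)))"
  proof (rule sum.cong)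
    fix j assume "j \<in> {..N}"
    then have j: "j \<le> N" by simp
    have "x ^ (N - j) * deviation j (d j) x =
        (\<Sum>m\<le>j. x ^ (N - m) * scale ((-1) ^ (j + m) * of_nat (j choose m)) (d j (x ^ m)))"
      unfolding deviation_def sum_distrib_left
    proof (rule sum.cong)
      fix m assume "m \<in> {..j}"
      then have "x ^ (N - m) = x ^ (N - j) * x ^ (j - m)"
        using j by (simp flip: power_add)
      then show "x ^ (N - j) * scale ((-1) ^ (j + m) * of_nat (j choose m)) (x ^ (j - m) * d j (x ^ m)) =
          x ^ (N - m) * scale ((-1) ^ (j + m) * of_nat (j choose m)) (d j (x ^ m))"
        by (simp add: mult_scale_right mult.assoc)
    qed simp
    \<comment> \<open>The range is extended to a common bound \<open>N\<close> by vanishing binomial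
      coefficients, so that the sums can be swapped.\<close>
    also have "\<dots> = (\<Sum>m\<le>N. x ^ (N - m) * scale ((-1) ^ (j + m) * of_nat (j choose m)) (d j (x ^ m)))"
      using j by (intro sum.mono_neutral_left) (simp_all add: not_le binomial_eq_0)
    finally show "x ^ (N - j) * deviation j (d j) x = \<dots>" .
  qed simp
  also have "\<dots> = (\<Sum>m\<le>N. x ^ (N - m) *
      (\<Sum>j\<le>N. scale ((-1) ^ (j + m) * of_nat (j choose m)) (d j (x ^ m))))"
    by (subst sum.swap) (simp add: sum_distrib_left)
  finally show ?thesis .
qed

text \<open>After swapping the sums, orthogonality gives the coefficient of each
  \<open>v m\<close>.\<close>

lemma binomial_inversion:
  assumes "t \<le> N"
  shows "(\<Sum>j\<le>N. scale ((-1) ^ (j + t) * of_nat (j choose t))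
    (\<Sum>m\<le>N. scale (of_nat (m choose j)) (v m))) = v t"
proof -
  have "(\<Sum>j\<le>N. scale ((-1) ^ (j + t) * of_nat (j choose t))
      (\<Sum>m\<le>N. scale (of_nat (m choose j)) (v m))) =
      (\<Sum>m\<le>N. scale (\<Sum>j\<le>N. (-1) ^ (j + t) * of_nat (j choose t) * of_nat (m choose j)) (v m))"
    unfolding scale_sum_right scale_sum_left by (subst sum.swap) simp
  also have "\<dots> = (\<Sum>m\<le>N. if m = t then v m else 0)"
    by (intro sum.cong) (auto simp: binomial_orthogonality)
  also have "\<dots> = v t" using assms by simp
  finally show ?thesis .
qed

lemma deviation_binomial_sum_eq_0:
  assumes "\<And>m. m \<le> N \<Longrightarrow> Modules.additive (f m)"
    and "\<And>x. (\<Sum>m\<le>N. x ^ (N - m) * f m (x ^ m)) = 0"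
    and "p \<le> N"
  shows "deviation p (\<lambda>y. \<Sum>m\<le>N. scale (of_nat (m choose p)) (f m y)) x = 0"
  using assms
proof (induction N arbitrary: f p x)
  case 0
  \<comment> \<open>In degree 0 hypothesis and claim both reduce to
    \<open>f 0 1 = 0\<close>.\<close>
  then show ?case using "0.prems"(2)[of 1] by (simp add: deviation_def)
next
  case (Suc M)
  define d where "d p y = (\<Sum>m\<le>Suc M. scale (of_nat (m choose p)) (f m y))" for p y
  have lower: "deviation j (d j) x = 0" if "j \<le> M" for j x
  proof -
    \<comment> \<open>The family of degree \<open>M\<close> that \<open>linearize\<close> produces
      for \<open>a = 1\<close>.\<close>
    define g where "g m y = scale (of_nat (Suc M - m)) (f m y) + scale (of_nat (Suc m)) (f (Suc m) y)"
      for m y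
    have "deviation j (\<lambda>y. \<Sum>m\<le>M. scale (of_nat (m choose j)) (g m y)) x = 0"
    proof (rule Suc.IH)
      show "Modules.additive (g m)" if "m \<le> M" for m
        using additive.add[OF Suc.prems(1)[of m]] additive.add[OF Suc.prems(1)[of "Suc m"]] that
        by (simp add: additive_def g_def scale_right_distrib ac_simps del: of_nat_Suc)
      show "(\<Sum>m\<le>M. y ^ (M - m) * g m (y ^ m)) = 0" for y
        using linearize[of M f y 1, OF Suc.prems(1,2)] by (simp add: g_def del: of_nat_Suc)
    qed (use that in simp)
    moreover have "(\<Sum>m\<le>M. scale (of_nat (m choose j)) (g m y)) = scale (of_nat (Suc M - j)) (d j y)" for y
    proof -
      \<comment> \<open>The two contributions to the coefficient of \<open>f m\<close>, after
        shifting the second sum. At \<open>m = 0\<close> the truncated \<open>m - 1\<close> is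
        multiplied by 0; for \<open>j > m\<close> all binomial coefficients involved vanish.\<close>
      have coeff: "of_nat (m choose j) * of_nat (Suc M - m) + of_nat m * of_nat ((m - 1) choose j) =
          (of_nat (Suc M - j) * of_nat (m choose j) :: rat)" if "m \<le> Suc M" for m
      proof -
        have "m * ((m - 1) choose j) = (m - j) * (m choose j)"
          using binomial_absorb_comp[of m j] by simp
        moreover have "(Suc M - j) * (m choose j) = (Suc M - m) * (m choose j) + (m - j) * (m choose j)"
        proof (cases "j \<le> m")
          case True
          then have "Suc M - j = (Suc M - m) + (m - j)" using that by simp
          then show ?thesis by (simp add: distrib_right)
        qed simp
        ultimately have "(m choose j) * (Suc M - m) + m * ((m - 1) choose j) = (Suc M - j) * (m choose j)"
          by (simp add: mult.commute)
        then show ?thesis by (metis of_nat_add of_nat_mult)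
      qed
      have "(\<Sum>m\<le>M. scale (of_nat (m choose j)) (g m y)) =
          (\<Sum>m\<le>M. scale (of_nat (m choose j) * of_nat (Suc M - m)) (f m y)) +
          (\<Sum>m\<le>M. scale (of_nat (Suc m) * of_nat (m choose j)) (f (Suc m) y))"
        by (simp add: g_def scale_right_distrib sum.distrib mult.commute del: of_nat_Suc)
      also have "(\<Sum>m\<le>M. scale (of_nat (m choose j) * of_nat (Suc M - m)) (f m y)) =
          (\<Sum>m\<le>Suc M. scale (of_nat (m choose j) * of_nat (Suc M - m)) (f m y))"
        by simp
      also have "(\<Sum>m\<le>M. scale (of_nat (Suc m) * of_nat (m choose j)) (f (Suc m) y)) =
          (\<Sum>m\<le>Suc M. scale (of_nat m * of_nat ((m - 1) choose j)) (f m y))"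
        by (subst sum.atMost_Suc_shift) simp
      also have "(\<Sum>m\<le>Suc M. scale (of_nat (m choose j) * of_nat (Suc M - m)) (f m y)) + \<dots> =
          (\<Sum>m\<le>Suc M. scale (of_nat (Suc M - j) * of_nat (m choose j)) (f m y))"
        unfolding sum.distrib[symmetric] scale_left_distrib[symmetric]
        by (intro sum.cong refl arg_cong2[where f = scale] coeff) simp
      also have "\<dots> = scale (of_nat (Suc M - j)) (d j y)"
        by (simp add: d_def scale_sum_right scale_right_distrib del: sum.atMost_Suc)
      finally show ?thesis .
    qed
    ultimately have "scale (of_nat (Suc M - j)) (deviation j (d j) x) = 0"
      by (simp add: deviation_scale)
    then show ?thesis using that by auto
  qed
  \<comment> \<open>Binomial inversion turns this sum back into the given equation. Once the lower
    terms are known to vanish, only \<open>j = Suc M\<close> remains.\<close>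
  have "(\<Sum>j\<le>Suc M. x ^ (Suc M - j) * deviation j (d j) x) = 0"
    unfolding sum_deviation unfolding d_def
    using Suc.prems(2)[of x] by (simp add: binomial_inversion del: sum.atMost_Suc)
  then have "deviation (Suc M) (d (Suc M)) x = 0"
    using lower by simp
  then have "deviation p (d p) x = 0"
    using lower Suc.prems(3) by (cases "p = Suc M") auto
  then show ?case unfolding d_def .
qed

text \<open>Substitution of \<open>j = n + 1 - i + k\<close> and symmetry of binomial coefficients
  bring the formula of the theorem into the shape of \<open>binomial_inversion\<close>. The added
  terms \<open>j < n + 1 - i\<close> vanish, among them \<open>j = 0\<close>, where
  \<open>j - 1\<close> is truncated.\<close>

lemma signed_binomial_sum_reindex:
  assumes "i \<le> n"
  shows "scale ((-1) ^ i) (\<Sum>k=0..i. scale (of_nat ((n + 1 - i + k) choose k)) (E (n - i + k))) =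
    (\<Sum>j\<le>n + 1. scale ((-1) ^ (j + (n + 1 - i)) * of_nat (j choose (n + 1 - i)))
      (scale ((-1) ^ (n + 1 + j)) (E (j - 1))))"
proof -
  have sign: "(-1) ^ i * c = (-1) ^ (j + (n + 1 - i)) * c * (-1) ^ (n + 1 + j)" for j and c :: rat
    using assms by (auto simp: minus_one_power_iff)
  have choose: "(n + 1 - i + k) choose k = (n + 1 - i + k) choose (n + 1 - i)" for k
    using binomial_symmetric[of k "n + 1 - i + k"] by simp
  have "scale ((-1) ^ i) (\<Sum>k=0..i. scale (of_nat ((n + 1 - i + k) choose k)) (E (n - i + k))) =
      (\<Sum>k=0..i. scale ((-1) ^ i * of_nat ((n + 1 - i + k) choose (n + 1 - i))) (E (n - i + k)))"
    by (simp only: scale_sum_right scale_scale choose)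
  also have "\<dots> = (\<Sum>j=n+1-i..n+1. scale ((-1) ^ i * of_nat (j choose (n + 1 - i))) (E (j - 1)))"
    by (rule sum.reindex_bij_witness[where i = "\<lambda>j. j - (n + 1 - i)" and j = "\<lambda>k. n + 1 - i + k"])
      (use assms in auto)
  also have "\<dots> = (\<Sum>j\<le>n + 1. scale ((-1) ^ i * of_nat (j choose (n + 1 - i))) (E (j - 1)))"
    by (intro sum.mono_neutral_left) (auto simp: not_le)
  finally show ?thesis by (simp only: scale_scale sign[symmetric])
qed

end

section \<open>Solutions of the functional equation\<close>

theorem corollary4:
  fixes scale :: "rat \<Rightarrow> 'a::{comm_ring, comm_monoid_mult} \<Rightarrow> 'a"
    and f :: "nat \<Rightarrow> 'a \<Rightarrow> 'a"
    and n :: nat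
  assumes "vector_space scale"
    and "n \<ge> 1"
    and "\<forall>i\<in>{1..n+1}. Modules.additive (f i)"
    and "\<forall>i\<in>{1..n+1}. f i 1 = 0"
  shows "(\<forall>x. (\<Sum>i=0..n. x ^ i * f (n + 1 - i) (x ^ (n + 1 - i))) = 0) \<longleftrightarrow>
    (\<exists>D :: nat \<Rightarrow> 'a \<Rightarrow> 'a.
      (\<forall>j\<in>{0..n}. D j \<in> derivations j) \<and>
      (\<forall>i\<in>{0..n}. \<forall>x. f (n + 1 - i) x =
         scale ((-1) ^ i)
           (\<Sum>k=0..i. scale (of_nat ((n + 1 - i + k) choose k)) (D (n - i + k) x))))"
proof -
  interpret rational_algebra scale
    using assms(1) by (simp add: rational_algebra_def)
  \<comment> \<open>With \<open>i = n + 1 - m\<close>, the sum over \<open>i\<close> omits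
    \<open>m = 0\<close>; the condition on \<open>g 0\<close> makes that term vanish.\<close>
  have reindex: "(\<Sum>m\<le>n + 1. x ^ (n + 1 - m) * g m (x ^ m)) =
      (\<Sum>i=0..n. x ^ i * g (n + 1 - i) (x ^ (n + 1 - i)))"
    if "g 0 1 = 0" for g :: "nat \<Rightarrow> 'a \<Rightarrow> 'a" and x
  proof -
    have "(\<Sum>m\<le>n + 1. x ^ (n + 1 - m) * g m (x ^ m)) = (\<Sum>m=1..n+1. x ^ (n + 1 - m) * g m (x ^ m))"
      using that by (intro sum.mono_neutral_right) (auto simp: Suc_le_eq)
    also have "\<dots> = (\<Sum>i=0..n. x ^ i * g (n + 1 - i) (x ^ (n + 1 - i)))"
      by (rule sum.reindex_bij_witness[where i = "\<lambda>i. n + 1 - i" and j = "\<lambda>m. n + 1 - m"]) auto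
    finally show ?thesis .
  qed
  show ?thesis
  proof
    assume eq: "\<forall>x. (\<Sum>i=0..n. x ^ i * f (n + 1 - i) (x ^ (n + 1 - i))) = 0"
    \<comment> \<open>\<open>f 0\<close> does not occur in the theorem and is arbitrary.\<close>
    define g where "g = f(0 := \<lambda>_. 0)"
    have g_add: "Modules.additive (g m)" if "m \<le> n + 1" for m
      using assms(3) that by (auto simp: g_def additive_def)
    have g_one: "g m 1 = 0" if "m \<le> n + 1" for m
      using assms(4) that by (auto simp: g_def)
    have g_eq: "(\<Sum>m\<le>n + 1. x ^ (n + 1 - m) * g m (x ^ m)) = 0" for x
      by (subst reindex) (use eq in \<open>simp_all add: g_def\<close>)
    define d where "d p y = (\<Sum>m\<le>n + 1. scale (of_nat (m choose p)) (g m y))" for p y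
    have d_dev: "deviation p (d p) x = 0" if "p \<le> n + 1" for p x
      unfolding d_def using g_add g_eq that by (rule deviation_binomial_sum_eq_0)
    \<comment> \<open>The index shift matches \<open>deviation (Suc j)\<close> with order
      \<open>j\<close>; the sign cancels the factor \<open>(-1) ^ (n + 1 + j)\<close> of
      \<open>signed_binomial_sum_reindex\<close>.\<close>
    define D where "D j y = scale ((-1) ^ (n + j)) (d (Suc j) y)" for j y
    have "D j \<in> derivations j" if "j \<le> n" for j
    proof -
      have "derivation_of_order j (D j)"
      proof (rule deviation_eq_0_imp_derivation_of_order)
        show "Modules.additive (D j)"
          by (simp add: additive_def D_def d_def additive.add[OF g_add] scale_right_distrib
              sum.distrib del: sum.atMost_Suc)
        show "D j 1 = 0"
          by (simp add: D_def d_def g_one)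
        show "deviation (Suc j) (D j) x = 0" for x
          unfolding D_def deviation_scale using d_dev that by simp
      qed
      then show ?thesis by (simp add: derivations_def)
    qed
    moreover have "f (n + 1 - i) x = scale ((-1) ^ i)
        (\<Sum>k=0..i. scale (of_nat ((n + 1 - i + k) choose k)) (D (n - i + k) x))" if "i \<le> n" for i x
    proof -
      have "scale ((-1) ^ i)
          (\<Sum>k=0..i. scale (of_nat ((n + 1 - i + k) choose k)) (D (n - i + k) x)) =
          (\<Sum>j\<le>n + 1. scale ((-1) ^ (j + (n + 1 - i)) * of_nat (j choose (n + 1 - i)))
            (scale ((-1) ^ (n + 1 + j)) (D (j - 1) x)))"
        by (rule signed_binomial_sum_reindex[OF that])
      also have "\<dots> = (\<Sum>j\<le>n + 1. scale ((-1) ^ (j + (n + 1 - i)) * of_nat (j choose (n + 1 - i))) (d j x))"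
      proof (rule sum.cong)
        fix j assume "j \<in> {..n + 1}"
        show "scale ((-1) ^ (j + (n + 1 - i)) * of_nat (j choose (n + 1 - i)))
            (scale ((-1) ^ (n + 1 + j)) (D (j - 1) x)) =
          scale ((-1) ^ (j + (n + 1 - i)) * of_nat (j choose (n + 1 - i))) (d j x)"
        proof (cases j)
          case 0
          \<comment> \<open>\<open>D (0 - 1)\<close> is unrelated to \<open>d 0\<close>, but the
            coefficient is 0 because \<open>n + 1 - i\<close> is positive.\<close>
          then show ?thesis using that by (simp add: binomial_eq_0)
        next
          case (Suc l)
          have "(-1) ^ (n + 1 + j) * (-1) ^ (n + l) = (1 :: rat)"
            by (simp add: Suc flip: power_add mult_2)
          then show ?thesis by (simp add: D_def Suc del: power_Suc binomial_Suc_Suc)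
        qed
      qed simp
      also have "\<dots> = g (n + 1 - i) x"
        unfolding d_def by (rule binomial_inversion) simp
      also have "\<dots> = f (n + 1 - i) x"
        using that by (simp add: g_def)
      finally show ?thesis by simp
    qed
    ultimately show "\<exists>D. (\<forall>j\<in>{0..n}. D j \<in> derivations j) \<and>
      (\<forall>i\<in>{0..n}. \<forall>x. f (n + 1 - i) x = scale ((-1) ^ i)
         (\<Sum>k=0..i. scale (of_nat ((n + 1 - i + k) choose k)) (D (n - i + k) x)))"
      by (intro exI[of _ D]) auto
  next
    assume "\<exists>D. (\<forall>j\<in>{0..n}. D j \<in> derivations j) \<and>
      (\<forall>i\<in>{0..n}. \<forall>x. f (n + 1 - i) x = scale ((-1) ^ i)
         (\<Sum>k=0..i. scale (of_nat ((n + 1 - i + k) choose k)) (D (n - i + k) x)))"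
    then obtain D where "\<forall>j\<in>{0..n}. D j \<in> derivations j"
      and "\<forall>i\<in>{0..n}. \<forall>x. f (n + 1 - i) x = scale ((-1) ^ i)
         (\<Sum>k=0..i. scale (of_nat ((n + 1 - i + k) choose k)) (D (n - i + k) x))"
      by blast
    then have D: "\<And>j. j \<le> n \<Longrightarrow> derivation_of_order j (D j)"
      and f: "\<And>i x. i \<le> n \<Longrightarrow> f (n + 1 - i) x = scale ((-1) ^ i)
         (\<Sum>k=0..i. scale (of_nat ((n + 1 - i + k) choose k)) (D (n - i + k) x))"
      by (simp_all add: derivations_def)
    \<comment> \<open>Inverts the passage from \<open>d\<close> to \<open>D\<close> of the other
      direction. By truncation \<open>d 0\<close> is built from \<open>D 0\<close>, which is the
      zero map.\<close>
    define d where "d j y = scale ((-1) ^ (n + 1 + j)) (D (j - 1) y)" for j y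
    \<comment> \<open>The inversion formula extends \<open>f\<close> to index 0, as
      \<open>sum_deviation\<close> requires.\<close>
    define g where "g m y = (\<Sum>j\<le>n + 1. scale ((-1) ^ (j + m) * of_nat (j choose m)) (d j y))" for m y
    have D_one: "D j 1 = 0" if "j \<le> n" for j
      using derivation_of_order_one[OF D[OF that]] .
    have d_dev: "deviation j (d j) x = 0" if "j \<le> n + 1" for j x
    proof (cases j)
      case 0
      then show ?thesis by (simp add: deviation_def d_def D_one)
    next
      case (Suc l)
      then have "deviation (Suc l) (D l) x = 0"
        using that by (intro derivation_of_order_imp_deviation_eq_0 D) simp
      then show ?thesis unfolding d_def deviation_scale by (simp add: Suc)
    qed
    have f_eq: "f (n + 1 - i) x = g (n + 1 - i) x" if "i \<le> n" for i x
      unfolding f[OF that] g_def d_def by (rule signed_binomial_sum_reindex[OF that])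
    have "g 0 1 = 0"
      unfolding g_def d_def by (intro sum.neutral) (auto simp: D_one)
    have "(\<Sum>i=0..n. x ^ i * f (n + 1 - i) (x ^ (n + 1 - i))) = 0" for x
    proof -
      have "(\<Sum>i=0..n. x ^ i * f (n + 1 - i) (x ^ (n + 1 - i))) =
          (\<Sum>m\<le>n + 1. x ^ (n + 1 - m) * g m (x ^ m))"
        unfolding reindex[of g, OF \<open>g 0 1 = 0\<close>] by (intro sum.cong refl) (simp only: atLeastAtMost_iff f_eq)
      also have "\<dots> = (\<Sum>j\<le>n + 1. x ^ (n + 1 - j) * deviation j (d j) x)"
        unfolding g_def sum_deviation ..
      also have "\<dots> = 0" by (intro sum.neutral) (simp add: d_dev)
      finally show ?thesis .
    qed
    then show "\<forall>x. (\<Sum>i=0..n. x ^ i * f (n + 1 - i) (x ^ (n + 1 - i))) = 0" by blast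
  qed
qed

end
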